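(* For every integer $r\ge 0$, the exponential generating function of the sequence $(D_r(n))_{n\ge 0}$ is $$\sum_{n=0}^{\infty}\frac{D_r(n)}{n!}x^n=\frac{x^r e^{-x}}{(1-x)^{r+1}}.$$
   Context: For integers $n,r\ge 0$, the $r$-derangement number $D_r(n)$ is the number of permutations of $\{1,\dots,n+r\}$ that have no fixed points and in whose cycle decomposition the elements $1,\dots,r$ lie in pairwise distinct cycles. In particular $D_0(n)=D(n)$ is the classical derangement number (with $D(0)=1$), and $D_r(n)=0$ if $n<r$. The identity is one of formal power series in $x$. *)

theory Defs
  imports
    "HOL-Combinatorics.Orbits"
    "HOL-Computational_Algebra.Formal_Power_Series"
begin

text \<open>
  For a permutation \<open>p\<close> of a finite set, \<open>orbit p i\<close> is the set of elements of the cycle of \<open>p\<close>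
  that contains \<open>i\<close>, so injectivity of \<open>orbit p\<close> on \<open>{1..r}\<close> says that \<open>1, \<dots>, r\<close> lie in pairwise
  distinct cycles.
\<close>

definition r_derangements :: "nat \<Rightarrow> nat \<Rightarrow> (nat \<Rightarrow> nat) set" where
  "r_derangements r n =
     {p. p permutes {1..n + r} \<and> (\<forall>i\<in>{1..n + r}. p i \<noteq> i) \<and> inj_on (orbit p) {1..r}}"

definition r_derangement_number :: "nat \<Rightarrow> nat \<Rightarrow> nat" where
  "r_derangement_number r n = card (r_derangements r n)"

end

theory Submission
  imports Defs
begin

text \<open>
  Drop the fixed-point condition first. Inserting the elements \<open>r + 1, \<dots>, r + n\<close> one at a time, each
  either as a fixed point or just before an existing element of a cycle, there are
  \<open>(r + 1) \<cdots> (r + n)\<close> permutations separating \<open>1, \<dots>, r\<close>, with exponential generating function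
  \<open>1 / (1 - x)^(r + 1)\<close>. Moebius inversion over the set of non-fixed points then gives
  \<open>\<Sum>i\<le>r. (r choose i) (-1)^(r - i) exp(-x) / (1 - x)^(i + 1)\<close>, which the binomial theorem
  collapses because \<open>1 / (1 - x) - 1 = x / (1 - x)\<close>.
\<close>

unbundle fps_syntax

section \<open>Counting permutations that separate the points of a set\<close>

definition separating_perms :: "'a set \<Rightarrow> 'a set \<Rightarrow> ('a \<Rightarrow> 'a) set" where
  "separating_perms R S = {p. p permutes S \<and> inj_on (orbit p) (R \<inter> S)}"

text \<open>Only the points of \<open>R \<inter> S\<close> have to be separated, so \<open>R\<close>
  can stay fixed while \<open>S\<close> runs over arbitrary subsets in the inversion.\<close>

definition separating_derangements :: "'a set \<Rightarrow> 'a set \<Rightarrow> ('a \<Rightarrow> 'a) set" where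
  "separating_derangements R S = {p \<in> separating_perms R S. \<forall>x\<in>S. p x \<noteq> x}"

lemma finite_separating_perms: "finite S \<Longrightarrow> finite (separating_perms R S)"
  unfolding separating_perms_def by (rule finite_subset[OF _ finite_permutations]) auto

text \<open>Finiteness makes forward reachability symmetric, so orbits are whole cycles. Equality of
  cycles thus becomes membership, which is open to induction on \<open>orbit\<close>.\<close>

lemma permutes_orbit_eq_iff:
  assumes "p permutes S" "finite S"
  shows "orbit p x = orbit p y \<longleftrightarrow> x \<in> orbit p y"
proof -
  have perm: "permutation p"
    using assms permutation_permutes by blast
  have self: "z \<in> orbit p z" for z
    using perm by (rule permutation_self_in_orbit)
  show ?thesis
    using self orbit_trans orbit_swap by (metis subsetI subset_antisym)
qed

text \<open>
  If \<open>b \<noteq> a\<close>, composing with \<open>transpose a b\<close> inserts \<open>a\<close> into the cycle of \<open>b\<close>, just before \<open>b\<close>.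
\<close>

lemma orbit_transpose_comp_iff:
  assumes q: "q permutes S" and a: "a \<notin> S" and x: "x \<in> S" and y: "y \<in> S"
  shows "y \<in> orbit (transpose a b \<circ> q) x \<longleftrightarrow> y \<in> orbit q x"
proof (cases "b = a")
  case True
  then show ?thesis by (simp add: comp_def)
next
  case False
  define p where "p = transpose a b \<circ> q"
  have in_S: "z \<in> S" if "z \<in> orbit q x" for z
    using that by induct (use q x in \<open>auto simp: permutes_in_image\<close>)
  have pa: "p a = b"
    using q a by (simp add: p_def permutes_not_in)
  have p_a: "p z = a" if "q z = b" for z
    using that by (simp add: p_def)
  have p_q: "p z = q z" if "z \<in> S" "q z \<noteq> b" for z
  proof -
    have "q z \<noteq> a"
      using that(1) q a by (metis permutes_in_image)
    then show ?thesis using that by (simp add: p_def)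
  qed
  have "y \<in> orbit p x" if "y \<in> orbit q x" for y
    using that
  proof induct
    case base
    show ?case
      by (metis orbit.intros p_a p_q pa x)
  next
    case (step z)
    then show ?case
      by (metis orbit.intros p_a p_q pa in_S)
  qed
  \<comment> \<open>The orbit under \<open>p\<close> may pass through the new point
    \<open>a\<close>, which \<open>q\<close> does not reach from \<open>x\<close>. The invariant
    then records that the next point \<open>b\<close> is reached by \<open>q\<close>.\<close>
  moreover have "if y = a then b \<in> orbit q x else y \<in> orbit q x" if "y \<in> orbit p x" for y
    using that
  proof induct
    case base
    show ?case
      by (metis orbit.intros p_a p_q x a in_S)
  next
    case (step z)
    then show ?case
      by (metis orbit.intros p_a p_q pa in_S a False)
  qed
  ultimately show ?thesis
    using y a by (metis p_def)
qed

text \<open>The choice \<open>b = a\<close> leaves \<open>a\<close> fixed; any other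
  \<open>b\<close> lengthens one cycle. Either way the cycles restricted to \<open>S\<close> are
  unchanged, and \<open>a\<close>, lying outside \<open>R\<close>, adds no constraint.\<close>

lemma separating_perms_insert:
  assumes "finite S" "a \<notin> S" "a \<notin> R"
  shows "separating_perms R (insert a S) =
    (\<lambda>(b, q). transpose a b \<circ> q) ` (insert a S \<times> separating_perms R S)"
proof -
  have insert_iff: "p permutes insert a S \<longleftrightarrow>
      (\<exists>b q. p = transpose a b \<circ> q \<and> b \<in> insert a S \<and> q permutes S)" for p
    using permutes_insert[of a S] by (auto simp: set_eq_iff image_iff)
  have "R \<inter> insert a S = R \<inter> S"
    using assms by auto
  moreover have "inj_on (orbit (transpose a b \<circ> q)) (R \<inter> S) \<longleftrightarrow> inj_on (orbit q) (R \<inter> S)"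
    if q: "q permutes S" and b: "b \<in> insert a S" for b q
  proof -
    have p: "transpose a b \<circ> q permutes insert a S"
      unfolding insert_iff using q b by blast
    have "orbit (transpose a b \<circ> q) x = orbit (transpose a b \<circ> q) y \<longleftrightarrow> orbit q x = orbit q y"
      if "x \<in> S" "y \<in> S" for x y
      using that assms
      by (simp only: permutes_orbit_eq_iff[OF p] permutes_orbit_eq_iff[OF q]
          orbit_transpose_comp_iff[OF q assms(2)] finite_insert)
    then show ?thesis
      by (simp add: inj_on_def)
  qed
  ultimately have "p \<in> separating_perms R (insert a S) \<longleftrightarrow>
      (\<exists>b q. p = transpose a b \<circ> q \<and> b \<in> insert a S \<and> q \<in> separating_perms R S)" for p
    unfolding separating_perms_def mem_Collect_eq insert_iff by metis
  then show ?thesis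
    by (simp only: set_eq_iff image_iff Bex_def split_paired_Ex mem_Sigma_iff split_conv) blast
qed

lemma card_separating_perms_insert:
  assumes "finite S" "a \<notin> S" "a \<notin> R"
  shows "card (separating_perms R (insert a S)) = Suc (card S) * card (separating_perms R S)"
proof -
  have "inj_on (\<lambda>(b, q). transpose a b \<circ> q) (insert a S \<times> separating_perms R S)"
  proof (rule inj_onI, clarify)
    fix b c p q
    assume p: "p \<in> separating_perms R S" and q: "q \<in> separating_perms R S"
      and eq: "transpose a b \<circ> p = transpose a c \<circ> q"
    have "p a = a" "q a = a"
      using p q assms by (auto simp: separating_perms_def permutes_not_in)
    \<comment> \<open>Both \<open>p\<close> and \<open>q\<close> fix \<open>a\<close>, so the
      composite sends \<open>a\<close> to \<open>b\<close> and to \<open>c\<close>. Once these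
      agree, the transposition cancels because it is an involution.\<close>
    then have "b = c"
      using fun_cong[OF eq, of a] by simp
    moreover have "transpose a b \<circ> (transpose a b \<circ> p) = transpose a b \<circ> (transpose a b \<circ> q)"
      using eq \<open>b = c\<close> by simp
    ultimately show "b = c \<and> p = q"
      by (simp add: o_assoc)
  qed
  then show ?thesis
    using assms by (simp add: separating_perms_insert card_image card_cartesian_product)
qed

text \<open>Since \<open>x\<close> and \<open>p x\<close> share a cycle, separating all points of
  \<open>S\<close> forces \<open>p x = x\<close>. This starts the count.\<close>

lemma separating_perms_subset:
  assumes "finite S" "S \<subseteq> R"
  shows "separating_perms R S = {id}"
proof (intro equalityI subsetI)
  fix p assume p: "p \<in> separating_perms R S"
  then have perm: "p permutes S" and inj: "inj_on (orbit p) S"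
    using assms by (auto simp: separating_perms_def Int_absorb1)
  have "p x = x" for x
  proof (cases "x \<in> S")
    case True
    have "orbit p (p x) = orbit p x"
      using permutes_orbit_eq_iff[OF perm assms(1)] orbit.base by metis
    then show ?thesis
      using inj True perm by (meson inj_onD permutes_in_image)
  qed (use perm in \<open>simp add: permutes_not_in\<close>)
  then show "p \<in> {id}" by auto
next
  have id: "id permutes S" by (rule permutes_id)
  have "y = x" if "y \<in> orbit id x" for x y :: 'a
    using that by induct auto
  then show "p \<in> separating_perms R S" if "p \<in> {id}" for p
    using that id permutes_orbit_eq_iff[OF id assms(1)]
    by (auto simp: separating_perms_def inj_on_def)
qed

lemma card_separating_perms:
  assumes "finite S"
  shows "card (separating_perms R S) = pochhammer (Suc (card (S \<inter> R))) (card (S - R))"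
proof -
  \<comment> \<open>With \<open>A\<close> inside \<open>R\<close> held fixed, the k-th element added
    to \<open>B\<close> contributes the factor \<open>card A + k\<close>.\<close>
  have "card (separating_perms R (A \<union> B)) = pochhammer (Suc (card A)) (card B)"
    if "finite B" "finite A" "A \<subseteq> R" "B \<inter> R = {}" for A B
    using that
  proof (induction B)
    case empty
    then show ?case by (simp add: separating_perms_subset)
  next
    case (insert b B)
    then have "b \<notin> A \<union> B" "b \<notin> R" "A \<inter> B = {}" by auto
    then show ?case
      using insert by (simp add: card_separating_perms_insert pochhammer_Suc card_Un_disjoint mult.commute)
  qed
  from this[of "S - R" "S \<inter> R"] show ?thesis
    using assms by (auto simp: Int_Diff_Un)
qed

section \<open>Moebius inversion over the set of non-fixed points\<close>

lemma inj_on_orbit_moved_points_iff: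
  assumes "p permutes S" "finite S"
  shows "inj_on (orbit p) R \<longleftrightarrow> inj_on (orbit p) {x \<in> R. p x \<noteq> x}"
proof -
  \<comment> \<open>A fixed point is the whole of its cycle, so no other point shares that cycle and
    separation can only fail among moved points.\<close>
  have "x = y" if "orbit p x = orbit p y" "p x = x" for x y
    using that permutes_orbit_eq_iff[OF assms] orbit_eq_singleton_iff
    by (metis singletonD)
  then show ?thesis
    unfolding inj_on_def by (smt (verit, best) mem_Collect_eq)
qed

lemma separating_perms_conv_derangements:
  assumes "finite S"
  shows "separating_perms R S = (\<Union>T\<in>Pow S. separating_derangements R T)"
proof (intro equalityI subsetI)
  fix p assume "p \<in> separating_perms R S"
  then have p: "p permutes S" "inj_on (orbit p) (R \<inter> S)"
    by (auto simp: separating_perms_def)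
  define T where "T = {x \<in> S. p x \<noteq> x}"
  have "p permutes T"
    using p(1) by (rule permutes_superset) (auto simp: T_def)
  moreover have "inj_on (orbit p) (R \<inter> T)"
    using p(2) by (rule inj_on_subset) (auto simp: T_def)
  ultimately have "p \<in> separating_derangements R T"
    by (auto simp: separating_derangements_def separating_perms_def T_def)
  then show "p \<in> (\<Union>T\<in>Pow S. separating_derangements R T)"
    by (auto simp: T_def)
next
  fix p assume "p \<in> (\<Union>T\<in>Pow S. separating_derangements R T)"
  then obtain T where T: "T \<subseteq> S" "p permutes T" "inj_on (orbit p) (R \<inter> T)" "\<forall>x\<in>T. p x \<noteq> x"
    by (auto simp: separating_derangements_def separating_perms_def)
  have p: "p permutes S"
    using T(1,2) by (rule permutes_subset[rotated])
  have "{x \<in> R \<inter> S. p x \<noteq> x} = R \<inter> T"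
    using T permutes_not_in[OF T(2)] by blast
  then have "inj_on (orbit p) (R \<inter> S)"
    using inj_on_orbit_moved_points_iff[OF p assms, of "R \<inter> S"] T(3) by simp
  then show "p \<in> separating_perms R S"
    using p by (simp add: separating_perms_def)
qed

lemma card_separating_perms_conv_derangements:
  assumes "finite S"
  shows "card (separating_perms R S) = (\<Sum>T\<in>Pow S. card (separating_derangements R T))"
  unfolding separating_perms_conv_derangements[OF assms]
proof (rule card_UN_disjoint)
  show "\<forall>T\<in>Pow S. finite (separating_derangements R T)"
    using assms unfolding separating_derangements_def
    by (simp add: finite_separating_perms finite_subset)
  \<comment> \<open>The index \<open>T\<close> is recovered from \<open>p\<close> as its set of
    moved points, which makes the union disjoint.\<close>
  have "T = {x. p x \<noteq> x}" if "p \<in> separating_derangements R T" for p T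
    using that permutes_not_in[of p T]
    by (auto simp: separating_derangements_def separating_perms_def)
  then show "\<forall>T\<in>Pow S. \<forall>U\<in>Pow S. T \<noteq> U \<longrightarrow>
      separating_derangements R T \<inter> separating_derangements R U = {}"
    by blast
qed (use assms in simp)

lemma sum_card_Pow:
  fixes h :: "nat \<Rightarrow> 'b :: comm_semiring_1"
  assumes "finite A"
  shows "(\<Sum>T\<in>Pow A. h (card T)) = (\<Sum>k\<le>card A. of_nat (card A choose k) * h k)"
proof -
  have "(\<Sum>T\<in>Pow A. h (card T)) = (\<Sum>k\<le>card A. \<Sum>T\<in>{T \<in> Pow A. card T = k}. h (card T))"
    using assms by (intro sum.group[symmetric]) (auto intro: card_mono)
  also have "\<dots> = (\<Sum>k\<le>card A. of_nat (card A choose k) * h k)"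
    using assms by (intro sum.cong) (simp_all add: n_subsets)
  finally show ?thesis .
qed

lemma sum_Pow_Un:
  assumes "finite A" "finite B" "A \<inter> B = {}"
  shows "(\<Sum>T\<in>Pow (A \<union> B). h (T \<inter> A) (T \<inter> B)) = (\<Sum>U\<in>Pow A. \<Sum>V\<in>Pow B. h U V)"
  unfolding sum.cartesian_product
  by (rule sum.reindex_bij_witness[where i = "\<lambda>(U, V). U \<union> V" and j = "\<lambda>T. (T \<inter> A, T \<inter> B)"])
     (use assms in auto)

text \<open>In the Moebius sum over subsets \<open>T\<close>, sign and count depend only on the
  sizes of \<open>T \<inter> R\<close> and \<open>T \<inter> N\<close>. The sum therefore splits
  into two nested sums, each grouped by cardinality.\<close>

lemma of_nat_card_separating_derangements:
  assumes "finite R" "finite N" "R \<inter> N = {}"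
  shows "(of_nat (card (separating_derangements R (R \<union> N))) :: 'a :: comm_ring_1) =
    (\<Sum>i\<le>card R. of_nat (card R choose i) * (- 1) ^ (card R - i) *
      (\<Sum>j\<le>card N. of_nat (card N choose j) * (- 1) ^ (card N - j) * pochhammer (of_nat (Suc i)) j))"
    (is "_ = ?rhs")
proof -
  let ?g = "\<lambda>i j. (- 1) ^ (card R - i) * ((- 1) ^ (card N - j) * pochhammer (of_nat (Suc i)) j) :: 'a"
  have "(of_nat (card (separating_derangements R (R \<union> N))) :: 'a) =
      (\<Sum>T\<in>Pow (R \<union> N). (- 1) ^ (card (R \<union> N) - card T) * of_nat (card (separating_perms R T)))"
    using assms by (intro inclusion_exclusion_mobius) (simp_all add: card_separating_perms_conv_derangements)
  also have "\<dots> = (\<Sum>T\<in>Pow (R \<union> N). ?g (card (T \<inter> R)) (card (T \<inter> N)))"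
  proof (rule sum.cong)
    fix T assume "T \<in> Pow (R \<union> N)"
    then have T: "T = (T \<inter> R) \<union> (T \<inter> N)" "T - R = T \<inter> N" "finite T"
      using assms by (auto intro: finite_subset)
    have "card T = card (T \<inter> R) + card (T \<inter> N)"
      using assms by (subst T(1), subst card_Un_disjoint) auto
    moreover have "card (T \<inter> R) \<le> card R" "card (T \<inter> N) \<le> card N"
      using assms by (auto intro: card_mono)
    moreover have "card (R \<union> N) = card R + card N"
      using assms by (simp add: card_Un_disjoint)
    \<comment> \<open>The two cardinality bounds make the truncated subtraction split, so that the
      sign factors.\<close>
    ultimately have "card (R \<union> N) - card T = (card R - card (T \<inter> R)) + (card N - card (T \<inter> N))"
      by simp
    then show "(- 1) ^ (card (R \<union> N) - card T) * of_nat (card (separating_perms R T)) =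
        ?g (card (T \<inter> R)) (card (T \<inter> N))"
      using T by (simp only: card_separating_perms power_add pochhammer_of_nat mult.assoc)
  qed simp
  also have "\<dots> = (\<Sum>U\<in>Pow R. \<Sum>V\<in>Pow N. ?g (card U) (card V))"
    using assms by (rule sum_Pow_Un)
  also have "\<dots> = (\<Sum>U\<in>Pow R. \<Sum>j\<le>card N. of_nat (card N choose j) * ?g (card U) j)"
    using assms by (intro sum.cong refl sum_card_Pow)
  also have "\<dots> = (\<Sum>i\<le>card R. of_nat (card R choose i) *
      (\<Sum>j\<le>card N. of_nat (card N choose j) * ?g i j))"
    using assms by (intro sum_card_Pow)
  also have "\<dots> = ?rhs"
    by (simp add: sum_distrib_left mult_ac)
  finally show ?thesis .
qed

section \<open>Generating functions\<close>

lemma inverse_one_minus_fps_X_power: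
  "inverse (1 - fps_X) ^ Suc i =
    Abs_fps (\<lambda>n. pochhammer (of_nat (Suc i)) n / fact n :: 'a :: field_char_0)"
proof (rule fps_ext)
  fix n
  have "inverse (1 - fps_X) ^ Suc i =
      inverse ((1 - fps_const 1 * fps_X :: 'a fps) ^ Suc i)"
    by (simp only: fps_const_1_eq_1 mult_1 fps_inverse_power)
  \<comment> \<open>This is the negative binomial series; its coefficient binom(i + n, n) equals the
    rising factorial of i + 1 of length n divided by n!.\<close>
  also have "\<dots> $ n = of_nat (i + n) gchoose n"
    by (simp only: one_minus_const_fps_X_neg_power') (simp add: binomial_gbinomial)
  also have "\<dots> = pochhammer (of_nat (Suc i)) n / fact n"
    by (simp add: gbinomial_pochhammer' add.commute)
  finally show "inverse (1 - fps_X) ^ Suc i $ n =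
      Abs_fps (\<lambda>n. pochhammer (of_nat (Suc i)) n / fact n :: 'a) $ n"
    by simp
qed

theorem theorem3:
  fixes r :: nat
  shows "Abs_fps (\<lambda>n. of_nat (r_derangement_number r n) / fact n) =
    (fps_X ^ r * fps_exp (- 1) / (1 - fps_X) ^ (r + 1) :: 'a :: field_char_0 fps)"
proof -
  define u :: "'a fps" where "u = inverse (1 - fps_X)"
  have u: "u * (1 - fps_X) = 1"
    unfolding u_def by (rule inverse_mult_eq_1) simp
  have "Abs_fps (\<lambda>n. of_nat (r_derangement_number r n) / fact n) =
      (\<Sum>i\<le>r. of_nat (r choose i) * (- 1) ^ (r - i) * (u ^ Suc i * fps_exp (- 1)))"
  proof (rule fps_ext)
    fix n
    let ?N = "{r + 1..n + r}"
    have "{1..n + r} = {1..r} \<union> ?N" by auto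
    then have "r_derangements r n = separating_derangements {1..r} ({1..r} \<union> ?N)"
      by (auto simp: r_derangements_def separating_derangements_def separating_perms_def Int_absorb2)
    then have "(of_nat (r_derangement_number r n) / fact n :: 'a) =
      (\<Sum>i\<le>r. of_nat (r choose i) * (- 1) ^ (r - i) *
        (\<Sum>j\<le>n. of_nat (n choose j) * (- 1) ^ (n - j) * pochhammer (of_nat (Suc i)) j)) / fact n"
      using of_nat_card_separating_derangements[of "{1..r}" ?N]
      by (simp add: r_derangement_number_def)
    also have "\<dots> = (\<Sum>i\<le>r. of_nat (r choose i) * (- 1) ^ (r - i) *
        (\<Sum>j\<le>n. pochhammer (of_nat (Suc i)) j / fact j * ((- 1) ^ (n - j) / fact (n - j))))"
    proof -
      \<comment> \<open>Dividing by n! turns the binomial convolution into the Cauchy product of the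
        coefficients of \<open>u ^ Suc i\<close> and exp(-x).\<close>
      have "of_nat (n choose j) * a * b / fact n = b / fact j * (a / fact (n - j))"
        if "j \<le> n" for j and a b :: 'a
        using that by (simp add: binomial_fact)
      then show ?thesis
        unfolding sum_divide_distrib
        by (subst times_divide_eq_right[symmetric], subst sum_divide_distrib)
          (simp del: of_nat_Suc times_divide_eq_right times_divide_eq_left times_divide_times_eq)
    qed
    also have "\<dots> = (\<Sum>i\<le>r. of_nat (r choose i) * (- 1) ^ (r - i) * (u ^ Suc i * fps_exp (- 1))) $ n"
    proof -
      \<comment> \<open>The integer factors are constant series, so they pass through coefficient
        extraction.\<close>
      have "(of_nat (r choose i) * (- 1) ^ (r - i) * f) $ n = of_nat (r choose i) * (- 1) ^ (r - i) * f $ n"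
        for f :: "'a fps" and i
      proof -
        have "of_nat (r choose i) * (- 1) ^ (r - i) =
            fps_const (of_nat (r choose i) * (- 1) ^ (r - i) :: 'a)"
          by (simp add: fps_of_nat flip: fps_const_mult fps_const_power fps_const_neg)
        then show ?thesis by simp
      qed
      then show ?thesis
        unfolding u_def inverse_one_minus_fps_X_power fps_sum_nth
        by (simp only: fps_mult_nth[of "Abs_fps _"] fps_nth_Abs_fps fps_exp_nth atLeast0AtMost of_nat_fact)
    qed
    finally show "Abs_fps (\<lambda>n. of_nat (r_derangement_number r n) / fact n) $ n =
        (\<Sum>i\<le>r. of_nat (r choose i) * (- 1) ^ (r - i) * (u ^ Suc i * fps_exp (- 1))) $ n"
      by simp
  qed
  \<comment> \<open>One factor \<open>u\<close> of \<open>u ^ Suc i\<close> is pulled out, leaving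
    the binomial expansion of an r-th power.\<close>
  also have "\<dots> = u * fps_exp (- 1) * (u + (- 1)) ^ r"
    unfolding binomial_ring by (simp add: sum_distrib_left mult_ac)
  also have "u + (- 1) = u * fps_X"
    using u by (simp add: algebra_simps)
  also have "u * fps_exp (- 1) * (u * fps_X) ^ r = fps_X ^ r * fps_exp (- 1) * u ^ (r + 1)"
    by (simp add: power_mult_distrib mult_ac)
  also have "\<dots> = fps_X ^ r * fps_exp (- 1) / (1 - fps_X) ^ (r + 1)"
    by (simp add: u_def fps_divide_unit fps_inverse_power del: power_Suc)
  finally show ?thesis .
qed

end
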